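(* Let $n\ge3$, $\ell>0$ and fix $r_0>0$. For $a\in\mathbb{R}$ let $V(r)=\frac{r^2}{\ell^2}\left(1+\frac{a}{r^{n-1}}-\frac{r_0^n}{r^n}\right)$, let $r_+>0$ be the largest positive root of $V$, and let $$g=\frac1V dr^2+Vd\phi^2+r^2\sum_{i=1}^{n-2}(d\theta^i)^2,\qquad r\ge r_+,$$ where $\theta^i$ has period $\lambda_i>0$ (arbitrary) and $\phi$ has period $\beta=\frac{4\pi\ell^2}{r_+\left(n-1+r_0^n/r_+^n\right)}$. Let $$\overline r_0=\frac{r_+}{n}\left(n-1+\frac{r_0^n}{r_+^n}\right)$$ and let $g_{HM}$ be the Horowitz--Myers metric $$g_{HM}=\frac{1}{\frac{r^{2}}{\ell^{2}}\left(1-\frac{\overline{r}_{0}^{n}}{r^{n}}\right)}dr^{2}+\frac{r^{2}}{\ell^{2}}\left(1-\frac{\overline{r}_{0}^{n}}{r^{n}}\right)d\phi^{2}+r^{2}\sum_{i=1}^{n-2}(d\theta^{i})^{2},\qquad r\ge\overline r_0,$$ with $\theta^i$ of period $\lambda_i$ and $\phi$ of period $\frac{4\pi\ell^2}{n\overline r_0}=\beta$. Then the Hamiltonian energies satisfy $$E(g)\ge E(g_{HM}),$$ with equality if and only if $a=0$, in which case $g$ is the Horowitz--Myers metric $g_{HM}$.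
   Context: Hamiltonian energy. Let $\breve g=\frac{\ell^2}{r^2}dr^2+\frac{r^2}{\ell^2}d\phi^2+r^2\sum_{i=1}^{n-2}(d\theta^i)^2$ be the reference metric, with Levi-Civita connection $\breve\nabla$ and orthonormal frame $\breve e_1=\frac{r}{\ell}\partial_r$, $\breve e_2=\frac{\ell}{r}\partial_\phi$, $\breve e_i=\frac1r\partial_{\theta^{i-2}}$ ($3\le i\le n$), and dual coframe $\breve e^1,\dots,\breve e^n$. For a metric $g$ put $g_{ij}=g(\breve e_i,\breve e_j)$, $a_{ij}=g_{ij}-\delta_{ij}$, $\operatorname{tr}_{\breve g}(g)=\sum_i g_{ii}$, $\operatorname{tr}_{\breve g}(a)=\sum_i a_{ii}$, and $$\mathcal E=\breve\nabla^i g_{1i}-\breve\nabla_1\operatorname{tr}_{\breve g}(g)-\frac1\ell\left(a_{11}-g_{11}\operatorname{tr}_{\breve g}(a)\right),$$ where indices refer to the frame $\breve e_i$ and repeated indices are summed. Let $N=r$, $\lambda=\lambda_1\cdots\lambda_{n-2}$, and $\mathrm{Vol}(\breve T^{n-1})=2\pi\ell\lambda$ (the reference normalization, in which the $\phi$-circle is taken with period $2\pi\ell^2$). The Hamiltonian energy is $$E(g)=\frac{1}{4\,\mathrm{Vol}(\breve T^{n-1})}\lim_{r\to\infty}\int_{T_r^{n-1}}\mathcal E\,N\,\breve e^2\wedge\cdots\wedge\breve e^n,$$ where $T_r^{n-1}$ is the constant-$r$ torus in the metric whose energy is computed, with $\phi$ ranging over its period $\beta$ and $\theta^i$ over its period $\lambda_i$.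 *)

theory Defs
  imports "HOL-Analysis.Analysis"
begin

text \<open>
  Coordinates \<open>(r, \<phi>, \<theta>\<^sup>1, \<dots>, \<theta>\<^sup>n\<^sup>-\<^sup>2)\<close>; the type parameter \<open>'m\<close> indexes the \<open>\<theta>\<close>'s, so the
  dimension is \<open>n = CARD('m) + 2\<close>, which ranges over all \<open>n \<ge> 3\<close>. The same type indexes the
  orthonormal frame: \<open>Rad\<close>, \<open>Phi\<close> are the frame indices 1 and 2.
\<close>

datatype 'm coord = Rad | Phi | Theta 'm

instance coord :: (finite) finite
proof
  have "(UNIV :: 'a coord set) = {Rad, Phi} \<union> range Theta"
    by (auto intro: coord.exhaust)
  then show "finite (UNIV :: 'a coord set)"
    by (metis finite.emptyI finite.insertI finite_UnI finite_imageI finite_class.finite_UNIV)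
qed

text \<open>A 2-tensor field is given by its matrix of components in the coordinate basis.\<close>

type_synonym 'm point = "real ^ 'm coord"
type_synonym 'm tensor2 = "'m point \<Rightarrow> real ^ 'm coord ^ 'm coord"

definition torus_metric :: "(real \<Rightarrow> real) \<Rightarrow> (real \<Rightarrow> real) \<Rightarrow> 'm::finite tensor2" where
  "torus_metric A B x = (\<chi> i j. if i = j
     then (case i of Rad \<Rightarrow> A (x $ Rad) | Phi \<Rightarrow> B (x $ Rad) | Theta _ \<Rightarrow> (x $ Rad)\<^sup>2)
     else 0)"

definition ref_metric :: "real \<Rightarrow> 'm::finite tensor2" where
  "ref_metric l = torus_metric (\<lambda>r. l\<^sup>2 / r\<^sup>2) (\<lambda>r. r\<^sup>2 / l\<^sup>2)"

definition profile_metric :: "(real \<Rightarrow> real) \<Rightarrow> 'm::finite tensor2" where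
  "profile_metric V = torus_metric (\<lambda>r. 1 / V r) V"

definition profile :: "nat \<Rightarrow> real \<Rightarrow> real \<Rightarrow> real \<Rightarrow> real \<Rightarrow> real" where
  "profile n l r0 a r = r\<^sup>2 / l\<^sup>2 * (1 + a / r ^ (n - 1) - r0 ^ n / r ^ n)"

definition hm_profile :: "nat \<Rightarrow> real \<Rightarrow> real \<Rightarrow> real \<Rightarrow> real" where
  "hm_profile n l r0 r = r\<^sup>2 / l\<^sup>2 * (1 - r0 ^ n / r ^ n)"

definition partial :: "'m::finite coord \<Rightarrow> ('m point \<Rightarrow> real) \<Rightarrow> 'm point \<Rightarrow> real" where
  "partial k f x = deriv (\<lambda>t. f (x + t *\<^sub>R axis k 1)) 0"

text \<open>Levi-Civita connection of \<open>h\<close> in coordinates: \<open>christoffel h x k i j\<close> is \<open>\<Gamma>\<^sup>k\<^sub>i\<^sub>j\<close>.\<close>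

definition christoffel ::
    "'m::finite tensor2 \<Rightarrow> 'm point \<Rightarrow> 'm coord \<Rightarrow> 'm coord \<Rightarrow> 'm coord \<Rightarrow> real" where
  "christoffel h x k i j = 1 / 2 * (\<Sum>s\<in>UNIV. matrix_inv (h x) $ k $ s *
     (partial i (\<lambda>y. h y $ j $ s) x + partial j (\<lambda>y. h y $ i $ s) x
        - partial s (\<lambda>y. h y $ i $ j) x))"

text \<open>\<open>cov_deriv h g x k i j\<close> is \<open>(\<nabla>\<^sub>k g)\<^sub>i\<^sub>j\<close> in coordinates, \<open>\<nabla>\<close> the Levi-Civita connection of \<open>h\<close>.\<close>

definition cov_deriv :: "'m::finite tensor2 \<Rightarrow> 'm tensor2 \<Rightarrow> 'm point \<Rightarrow>
    'm coord \<Rightarrow> 'm coord \<Rightarrow> 'm coord \<Rightarrow> real" where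
  "cov_deriv h g x k i j = partial k (\<lambda>y. g y $ i $ j) x
     - (\<Sum>s\<in>UNIV. christoffel h x s k i * g x $ s $ j)
     - (\<Sum>s\<in>UNIV. christoffel h x s k j * g x $ i $ s)"

definition ref_frame :: "real \<Rightarrow> 'm::finite coord \<Rightarrow> 'm point \<Rightarrow> real ^ 'm coord" where
  "ref_frame l i x = (case i of
       Rad \<Rightarrow> (x $ Rad / l) *\<^sub>R axis Rad 1
     | Phi \<Rightarrow> (l / x $ Rad) *\<^sub>R axis Phi 1
     | Theta j \<Rightarrow> (1 / x $ Rad) *\<^sub>R axis (Theta j) 1)"

definition frame_comp :: "real \<Rightarrow> 'm::finite tensor2 \<Rightarrow> 'm point \<Rightarrow> 'm coord \<Rightarrow> 'm coord \<Rightarrow> real"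
  where "frame_comp l g x i j =
    (\<Sum>p\<in>UNIV. \<Sum>q\<in>UNIV. ref_frame l i x $ p * ref_frame l j x $ q * g x $ p $ q)"

definition frame_trace :: "real \<Rightarrow> 'm::finite tensor2 \<Rightarrow> 'm point \<Rightarrow> real" where
  "frame_trace l g x = (\<Sum>i\<in>UNIV. frame_comp l g x i i)"

definition frame_deriv :: "real \<Rightarrow> 'm::finite coord \<Rightarrow> ('m point \<Rightarrow> real) \<Rightarrow> 'm point \<Rightarrow> real" where
  "frame_deriv l i f x = (\<Sum>k\<in>UNIV. ref_frame l i x $ k * partial k f x)"

text \<open>\<open>frame_cov_deriv l g x k i j\<close> is \<open>(\<nabla>\<^sub>k g)\<^sub>i\<^sub>j\<close> in the frame, \<open>\<nabla>\<close> the reference connection.\<close>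

definition frame_cov_deriv :: "real \<Rightarrow> 'm::finite tensor2 \<Rightarrow> 'm point \<Rightarrow>
    'm coord \<Rightarrow> 'm coord \<Rightarrow> 'm coord \<Rightarrow> real" where
  "frame_cov_deriv l g x k i j = (\<Sum>s\<in>UNIV. \<Sum>p\<in>UNIV. \<Sum>q\<in>UNIV.
     ref_frame l k x $ s * ref_frame l i x $ p * ref_frame l j x $ q *
     cov_deriv (ref_metric l) g x s p q)"

text \<open>
  With \<open>a = g - ref_metric\<close>, the frame components of \<open>a\<close> are \<open>g\<^sub>i\<^sub>j - \<delta>\<^sub>i\<^sub>j\<close>. The frame is
  orthonormal for the reference metric, so raising an index leaves components unchanged.
\<close>

definition frame_diff :: "real \<Rightarrow> 'm::finite tensor2 \<Rightarrow> 'm point \<Rightarrow> 'm coord \<Rightarrow> 'm coord \<Rightarrow> real"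
  where "frame_diff l g x i j = frame_comp l g x i j - (if i = j then 1 else 0)"

definition energy_density :: "real \<Rightarrow> 'm::finite tensor2 \<Rightarrow> 'm point \<Rightarrow> real" where
  "energy_density l g x =
     (\<Sum>i\<in>UNIV. frame_cov_deriv l g x i Rad i)
     - frame_deriv l Rad (frame_trace l g) x
     - 1 / l * (frame_diff l g x Rad Rad
                - frame_comp l g x Rad Rad * (\<Sum>i\<in>UNIV. frame_diff l g x i i))"

definition torus_point :: "real \<Rightarrow> real \<times> (real ^ 'm) \<Rightarrow> 'm::finite point" where
  "torus_point r y = (\<chi> i. case i of Rad \<Rightarrow> r | Phi \<Rightarrow> fst y | Theta j \<Rightarrow> snd y $ j)"

text \<open>
  The coefficient with respect to \<open>d\<phi> \<and> d\<theta>\<^sup>1 \<and> \<dots> \<and> d\<theta>\<^sup>n\<^sup>-\<^sup>2\<close> of the \<open>(n-1)\<close>-form that is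
  integrated over the constant-\<open>r\<close> torus: the lapse is \<open>N = r\<close>, and the coframe dual to
  \<^const>\<open>ref_frame\<close> is \<open>(r/l) d\<phi>\<close> for \<open>Phi\<close> and \<open>r d\<theta>\<^sup>i\<close> for \<open>Theta i\<close>.
\<close>

definition energy_form :: "real \<Rightarrow> 'm::finite tensor2 \<Rightarrow> real \<Rightarrow> real \<times> (real ^ 'm) \<Rightarrow> real" where
  "energy_form l g r y = energy_density l g (torus_point r y) * r * (r / l * r ^ CARD('m))"

text \<open>A fundamental domain of the torus: \<open>\<phi>\<close> has period \<open>b\<close>, \<open>\<theta>\<^sup>i\<close> has period \<open>L $ i\<close>.\<close>

definition torus_cell :: "real \<Rightarrow> real ^ 'm \<Rightarrow> (real \<times> (real ^ 'm::finite)) set" where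
  "torus_cell b L = cbox (0, 0) (b, L)"

definition energy_flux :: "real \<Rightarrow> real \<Rightarrow> real ^ 'm \<Rightarrow> 'm::finite tensor2 \<Rightarrow> real \<Rightarrow> real" where
  "energy_flux l b L g r = (LINT y:torus_cell b L|lborel. energy_form l g r y)"

text \<open>
  Volume of the torus with metric \<open>l\<^sup>-\<^sup>2 d\<phi>\<^sup>2 + \<Sum> (d\<theta>\<^sup>i)\<^sup>2\<close> and \<open>\<phi>\<close> of reference period \<open>2 \<pi> l\<^sup>2\<close>; it does not depend
  on the actual period of \<open>\<phi>\<close>.
\<close>

definition ref_volume :: "real \<Rightarrow> real ^ 'm::finite \<Rightarrow> real" where
  "ref_volume l L = 2 * pi * l * (\<Prod>i\<in>UNIV. L $ i)"

definition hamiltonian_energy :: "real \<Rightarrow> real \<Rightarrow> real ^ 'm \<Rightarrow> 'm::finite tensor2 \<Rightarrow> real" where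
  "hamiltonian_energy l b L g = 1 / (4 * ref_volume l L) * Lim at_top (energy_flux l b L g)"

text \<open>The integrals and the limit in \<^const>\<open>hamiltonian_energy\<close> exist, so its value is not junk.\<close>

definition energy_well_defined :: "real \<Rightarrow> real \<Rightarrow> real ^ 'm \<Rightarrow> 'm::finite tensor2 \<Rightarrow> bool" where
  "energy_well_defined l b L g \<longleftrightarrow>
     (\<forall>\<^sub>F r in at_top. set_integrable lborel (torus_cell b L) (energy_form l g r)) \<and>
     (\<exists>E. (energy_flux l b L g \<longlongrightarrow> E) at_top)"

end

theory Submission
  imports Defs
begin

text \<open>
  Every tensor involved is diagonal in the coordinate basis with entries that depend on the radius
  alone. If \<open>f\<close> and \<open>k\<close> are the frame components of such a torus metric in the \<open>Rad\<close> and \<open>Phi\<close>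
  directions, then its energy density has the closed form
  \<open>1/l * (- r k' + (n - 1) f - k - (n - 2) - (f - 1) + f (f + k - 2))\<close>
  (\<open>energy_density_torus_metric\<close>). For the profile metric one has \<open>k = w\<close> and \<open>f = 1/w\<close> with
  \<open>w = 1 + u\<close> and \<open>u = a / r^(n-1) - r0^n / r^n\<close>. The part of the bracket linear in \<open>u\<close> is
  \<open>- r u' - (n - 1) u\<close>: this operator annihilates \<open>a / r^(n-1)\<close> and maps \<open>- r0^n / r^n\<close> to itself,
  so the parameter \<open>a\<close> drops out at leading order. The rest is \<open>u\<^sup>2\<close> times a bounded factor. The
  lapse and the area form contribute \<open>r^n / l\<close>, and \<open>r^n u\<^sup>2\<close> tends to 0 as soon as \<open>n \<ge> 3\<close>;
  hence the energy for the period \<open>b\<close> is \<open>- b r0^n / (8 \<pi> l^3)\<close> (\<open>energy_profile_metric\<close>).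

  The metrics \<open>g\<close> and \<open>g_HM\<close> (the case \<open>a = 0\<close> with parameter \<open>r0bar\<close>) have the same period, so the
  comparison of energies is the comparison of \<open>r0\<close> with \<open>r0bar\<close>. With \<open>x = r0 / rp\<close> the inequality
  \<open>r0 \<le> r0bar\<close> says \<open>n x \<le> n - 1 + x^n\<close>, which is Bernoulli's inequality, with equality only
  at \<open>x = 1\<close>. Since \<open>rp\<close> is a root of the profile, \<open>a / rp^(n-1) = x^n - 1\<close>, so \<open>x = 1\<close> means \<open>a = 0\<close>.
\<close>

section \<open>Diagonal tensors depending on the radius\<close>

lemma sum_coord:
  "(\<Sum>i\<in>UNIV. f i) = f Rad + f Phi + (\<Sum>j\<in>UNIV. f (Theta j))"
  for f :: "'m::finite coord \<Rightarrow> real"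
proof -
  have U: "(UNIV :: 'm coord set) = insert Rad (insert Phi (range Theta))"
    by (auto intro: coord.exhaust)
  have "inj (Theta :: 'm \<Rightarrow> _)" by (simp add: inj_def)
  then show ?thesis
    unfolding U by (simp add: image_iff sum.reindex add.assoc)
qed

text \<open>
  A shifted function has the same derivatives as \<open>F\<close>, so \<^const>\<open>deriv\<close> makes the same choice on both
  sides, also at points where there is no derivative.
\<close>

lemma partial_radial:
  fixes F :: "real \<Rightarrow> real" and x :: "'m::finite point"
  shows "partial k (\<lambda>y. F (y $ Rad)) x = (if k = Rad then deriv F (x $ Rad) else 0)"
proof (cases "k = Rad")
  case True
  have "((\<lambda>t. F (x $ Rad + t)) has_field_derivative D) (at 0)
      \<longleftrightarrow> (F has_field_derivative D) (at (x $ Rad))" for D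
    using DERIV_shift[of F D 0 "x $ Rad"] by (simp add: add.commute)
  then show ?thesis
    using True by (simp add: partial_def deriv_def)
next
  case False
  then show ?thesis by (simp add: partial_def axis_def)
qed

definition radial_diagonal :: "'m::finite tensor2 \<Rightarrow> ('m coord \<Rightarrow> real \<Rightarrow> real) \<Rightarrow> bool" where
  "radial_diagonal g G \<longleftrightarrow> (\<forall>x i j. g x $ i $ j = (if i = j then G i (x $ Rad) else 0))"

lemma radial_diagonalD:
  "radial_diagonal g G \<Longrightarrow> g x $ i $ j = (if i = j then G i (x $ Rad) else 0)"
  by (simp add: radial_diagonal_def)

lemma partial_radial_diagonal:
  assumes "radial_diagonal g G"
  shows "partial k (\<lambda>y. g y $ i $ j) x =
    (if i = j \<and> k = Rad then deriv (G i) (x $ Rad) else 0)"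
proof -
  have "partial k (\<lambda>_. 0) x = 0" by (simp add: partial_def)
  then show ?thesis
    by (cases "i = j") (simp_all add: radial_diagonalD[OF assms] partial_radial)
qed

lemma matrix_inv_diagonal:
  fixes M :: "real ^ 'k::finite ^ 'k"
  assumes M: "\<And>i j. M $ i $ j = (if i = j then d i else 0)" and d: "\<And>i. d i \<noteq> 0"
  shows "matrix_inv M $ i $ j = (if i = j then 1 / d i else 0)"
proof -
  let ?N = "(\<chi> i j. if i = j then 1 / d i else 0) :: real ^ 'k ^ 'k"
  have N: "M ** ?N = mat 1 \<and> ?N ** M = mat 1"
    using d by (simp add: matrix_matrix_mult_def mat_def M vec_eq_iff
        mult_delta_left mult_delta_right)
  then have I: "M ** matrix_inv M = mat 1 \<and> matrix_inv M ** M = mat 1"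
    unfolding matrix_inv_def by (rule someI)
  have "matrix_inv M = ?N ** M ** matrix_inv M"
    by (simp only: N matrix_mul_lid)
  also have "\<dots> = ?N ** (M ** matrix_inv M)"
    by (rule matrix_mul_assoc[symmetric])
  also have "\<dots> = ?N"
    by (simp only: I matrix_mul_rid)
  finally show ?thesis by simp
qed

lemma christoffel_radial_diagonal:
  assumes h: "radial_diagonal h H" and nz: "\<And>i. H i (x $ Rad) \<noteq> 0"
  shows "christoffel h x k i j = 1 / (2 * H k (x $ Rad)) *
     ((if j = k \<and> i = Rad then deriv (H k) (x $ Rad) else 0)
      + (if i = k \<and> j = Rad then deriv (H k) (x $ Rad) else 0)
      - (if i = j \<and> k = Rad then deriv (H i) (x $ Rad) else 0))"
proof -
  have inv: "matrix_inv (h x) $ p $ q = (if p = q then 1 / H p (x $ Rad) else 0)" for p q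
    using nz by (intro matrix_inv_diagonal[where d = "\<lambda>p. H p (x $ Rad)"])
      (simp_all only: radial_diagonalD[OF h] not_False_eq_True)
  have pick: "(\<Sum>s\<in>UNIV. (if k = s then c else 0) * f s) = c * f k" for c and f :: "_ \<Rightarrow> real"
    by (simp add: mult_delta_left)
  have scale: "1 / 2 * (1 / c * d) = 1 / (2 * c) * d" for c d :: real
    by simp
  show ?thesis
    unfolding christoffel_def inv partial_radial_diagonal[OF h] pick scale
    by (intro arg_cong2[where f = "(*)"] arg_cong2[where f = "(+)"] arg_cong2[where f = "(-)"] refl)
      (auto split: if_split)
qed

text \<open>
  The divergence \<open>\<nabla>\<^sup>i g\<^sub>1\<^sub>i\<close> only contains these components. A direction \<open>i \<noteq> Rad\<close> can contribute
  although \<open>g\<close> has no off-diagonal entries, because the tori of constant radius need not be totally geodesic for \<open>h\<close>: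
  both \<open>\<Gamma>\<^sup>i\<^sub>i\<^sub>r\<close> and \<open>\<Gamma>\<^sup>r\<^sub>i\<^sub>i\<close> are multiples of the radial derivative of \<open>H i\<close>.
\<close>

lemma cov_deriv_divergence_term:
  assumes h: "radial_diagonal h H" and nz: "\<And>i. H i (x $ Rad) \<noteq> 0"
    and g: "radial_diagonal g G"
  shows "cov_deriv h g x i Rad i =
    (if i = Rad then deriv (G Rad) (x $ Rad)
                     - deriv (H Rad) (x $ Rad) / H Rad (x $ Rad) * G Rad (x $ Rad)
     else deriv (H i) (x $ Rad) / 2 *
       (G Rad (x $ Rad) / H Rad (x $ Rad) - G i (x $ Rad) / H i (x $ Rad)))"
proof -
  have s1: "(\<Sum>s\<in>UNIV. christoffel h x s i Rad * g x $ s $ i)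
      = christoffel h x i i Rad * G i (x $ Rad)"
    by (simp add: radial_diagonalD[OF g] mult_delta_right)
  have s2: "(\<Sum>s\<in>UNIV. christoffel h x s i i * g x $ Rad $ s)
      = christoffel h x Rad i i * G Rad (x $ Rad)"
    by (simp add: radial_diagonalD[OF g] mult_delta_right)
  show ?thesis
    unfolding cov_deriv_def s1 s2
    unfolding partial_radial_diagonal[OF g] christoffel_radial_diagonal[OF h nz]
    by (simp add: nz algebra_simps)
qed

section \<open>The energy density of a torus metric\<close>

definition frame_scale :: "real \<Rightarrow> 'm coord \<Rightarrow> real \<Rightarrow> real" where
  "frame_scale l i r = (case i of Rad \<Rightarrow> r / l | Phi \<Rightarrow> l / r | Theta j \<Rightarrow> 1 / r)"

lemma ref_frame_nth: "ref_frame l i x $ p = (if p = i then frame_scale l i (x $ Rad) else 0)"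
  by (auto simp: ref_frame_def frame_scale_def axis_def split: coord.split)

lemma frame_comp_eq:
  "frame_comp l g x i j = frame_scale l i (x $ Rad) * frame_scale l j (x $ Rad) * g x $ i $ j"
  by (simp add: frame_comp_def ref_frame_nth mult_delta_left mult_delta_right)

lemma frame_deriv_eq:
  "frame_deriv l i f x = frame_scale l i (x $ Rad) * partial i f x"
  by (simp add: frame_deriv_def ref_frame_nth mult_delta_left)

lemma frame_cov_deriv_eq:
  "frame_cov_deriv l g x k i j = frame_scale l k (x $ Rad) * frame_scale l i (x $ Rad)
     * frame_scale l j (x $ Rad) * cov_deriv (ref_metric l) g x k i j"
  by (simp add: frame_cov_deriv_def ref_frame_nth mult_delta_left mult_delta_right)

definition torus_entry :: "(real \<Rightarrow> real) \<Rightarrow> (real \<Rightarrow> real) \<Rightarrow> 'm coord \<Rightarrow> real \<Rightarrow> real" where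
  "torus_entry A B i = (case i of Rad \<Rightarrow> A | Phi \<Rightarrow> B | Theta _ \<Rightarrow> \<lambda>r. r\<^sup>2)"

lemma radial_diagonal_torus_metric: "radial_diagonal (torus_metric A B) (torus_entry A B)"
  by (auto simp: radial_diagonal_def torus_metric_def torus_entry_def split: coord.split)

text \<open>
  The entries are written so that \<open>f\<close> and \<open>k\<close> are the frame components \<open>g\<^sub>1\<^sub>1\<close> and \<open>g\<^sub>2\<^sub>2\<close>. The
  derivative \<open>f'\<close> cancels in the result, since it enters once through the divergence and once through
  the trace with opposite signs.
\<close>

lemma energy_density_torus_metric:
  fixes x :: "'m::finite point"
  assumes l: "l > 0" and r: "x $ Rad > 0"
    and f: "(f has_real_derivative f') (at (x $ Rad))"
    and k: "(k has_real_derivative k') (at (x $ Rad))"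
  shows "energy_density l (torus_metric (\<lambda>r. l\<^sup>2 / r\<^sup>2 * f r) (\<lambda>r. r\<^sup>2 / l\<^sup>2 * k r)) x =
    1 / l * (- (x $ Rad) * k' + (real CARD('m) + 1) * f (x $ Rad) - k (x $ Rad) - real CARD('m)
      - (f (x $ Rad) - 1) + f (x $ Rad) * (f (x $ Rad) + k (x $ Rad) - 2))"
proof -
  define A where "A = (\<lambda>r. l\<^sup>2 / r\<^sup>2 * f r)"
  define B where "B = (\<lambda>r. r\<^sup>2 / l\<^sup>2 * k r)"
  define g :: "'m tensor2" where "g = torus_metric A B"
  define H :: "'m coord \<Rightarrow> real \<Rightarrow> real"
    where "H = torus_entry (\<lambda>r. l\<^sup>2 / r\<^sup>2) (\<lambda>r. r\<^sup>2 / l\<^sup>2)"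
  define r where "r = x $ Rad"
  have r0: "r > 0" using r by (simp add: r_def)
  note f = f[folded r_def] and k = k[folded r_def]
  have h: "radial_diagonal (ref_metric l :: 'm tensor2) H"
    unfolding ref_metric_def H_def by (rule radial_diagonal_torus_metric)
  have g: "radial_diagonal g (torus_entry A B)"
    unfolding g_def by (rule radial_diagonal_torus_metric)
  have nz: "H i (x $ Rad) \<noteq> 0" for i
    using l r by (auto simp: H_def torus_entry_def split: coord.split)
  have dA: "deriv A r = l\<^sup>2 / r\<^sup>2 * f' - 2 * l\<^sup>2 / r ^ 3 * f r"
    unfolding A_def using r0
    by (intro DERIV_imp_deriv)
       (auto intro!: derivative_eq_intros f simp: field_simps eval_nat_numeral)
  have dHr: "deriv (H Rad) r = - 2 * l\<^sup>2 / r ^ 3"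
    unfolding H_def torus_entry_def using r0
    by (intro DERIV_imp_deriv)
       (auto intro!: derivative_eq_intros simp: field_simps eval_nat_numeral)
  have dHp: "deriv (H Phi) r = 2 * r / l\<^sup>2"
    unfolding H_def torus_entry_def using r0 l
    by (intro DERIV_imp_deriv)
       (auto intro!: derivative_eq_intros simp: field_simps eval_nat_numeral)
  have dHt: "deriv (H (Theta j)) r = 2 * r" for j
    unfolding H_def torus_entry_def
    by (intro DERIV_imp_deriv) (auto intro!: derivative_eq_intros)
  have comp: "frame_comp l g y i j = (if i = j then (frame_scale l i (y $ Rad))\<^sup>2
      * torus_entry A B i (y $ Rad) else 0)" for y i j
    by (simp add: frame_comp_eq radial_diagonalD[OF g] power2_eq_square)
  have compx: "frame_comp l g x Rad Rad = f r" "frame_comp l g x Phi Phi = k r"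
    "frame_comp l g x (Theta j) (Theta j) = 1" for j
    using l r0 by (auto simp: comp frame_scale_def torus_entry_def A_def B_def r_def power_divide)
  have rad: "frame_cov_deriv l g x Rad Rad Rad = r / l * f'"
    unfolding frame_cov_deriv_eq cov_deriv_divergence_term[OF h nz g] 
    unfolding r_def[symmetric] dHr using l r0 dA
    by (simp add: frame_scale_def H_def torus_entry_def)
       (simp add: A_def field_simps eval_nat_numeral)
  have phi: "frame_cov_deriv l g x Phi Rad Phi = 1 / l * (f r - k r)"
    unfolding frame_cov_deriv_eq cov_deriv_divergence_term[OF h nz g] 
    unfolding r_def[symmetric] dHp using l r0
    by (simp add: frame_scale_def H_def torus_entry_def)
       (simp add: A_def B_def field_simps eval_nat_numeral)
  have theta: "frame_cov_deriv l g x (Theta j) Rad (Theta j) = 1 / l * (f r - 1)" for j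
    unfolding frame_cov_deriv_eq cov_deriv_divergence_term[OF h nz g] 
    unfolding r_def[symmetric] dHt using l r0
    by (simp add: frame_scale_def H_def torus_entry_def)
       (simp add: A_def B_def field_simps eval_nat_numeral)
  define F where "F = (\<lambda>s. (s / l)\<^sup>2 * A s + (l / s)\<^sup>2 * B s + real CARD('m) * ((1 / s)\<^sup>2 * s\<^sup>2))"
  have tr: "frame_trace l g = (\<lambda>y. F (y $ Rad))"
    by (simp add: fun_eq_iff frame_trace_def sum_coord comp frame_scale_def torus_entry_def F_def)
  \<comment> \<open>The closed form of the trace breaks down at radius 0, where the frame degenerates, so it is only
    used near \<open>r\<close>.\<close>
  have "((\<lambda>s. f s + k s + real CARD('m)) has_real_derivative f' + k') (at r)"
    by (auto intro!: derivative_eq_intros f k)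
  moreover have "\<forall>\<^sub>F s in nhds r. F s = f s + k s + real CARD('m)"
  proof (rule eventually_mono[OF eventually_nhds_in_open[of "{0<..}"]])
    fix s :: real assume "s \<in> {0<..}"
    then show "F s = f s + k s + real CARD('m)"
      using l by (simp add: F_def A_def B_def power_divide)
  qed (use r0 in auto)
  ultimately have dF: "deriv F r = f' + k'"
    by (intro DERIV_imp_deriv) (simp add: DERIV_cong_ev)
  have dtr: "frame_deriv l Rad (frame_trace l g) x = r / l * (f' + k')"
    unfolding frame_deriv_eq tr partial_radial using dF by (simp add: frame_scale_def r_def)
  show ?thesis
    unfolding A_def[symmetric] B_def[symmetric] g_def[symmetric] r_def[symmetric]
      energy_density_def dtr frame_diff_def
    using l by (simp add: sum_coord compx rad phi theta field_simps)
qed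

section \<open>The energy of a profile metric\<close>

lemma has_real_derivative_divide_power:
  fixes c x :: real
  assumes "x \<noteq> 0"
  shows "((\<lambda>x. c / x ^ k) has_real_derivative - (real k * c / x ^ Suc k)) (at x)"
proof -
  have "((\<lambda>x. c * inverse (x ^ k)) has_real_derivative
      c * - (real k * x ^ (k - Suc 0) * inverse ((x ^ k)\<^sup>2))) (at x)"
    using assms by (auto intro!: derivative_eq_intros simp: power2_eq_square)
  moreover have "c * - (real k * x ^ (k - Suc 0) * inverse ((x ^ k)\<^sup>2)) = - (real k * c / x ^ Suc k)"
    using assms by (cases k) (simp_all add: field_simps power2_eq_square)
  ultimately show ?thesis unfolding divide_inverse[of c] by (simp only:)
qed

text \<open>The frame component \<open>g\<^sub>2\<^sub>2\<close> of the profile metric; \<open>g\<^sub>1\<^sub>1\<close> is its reciprocal.\<close>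

definition warp :: "nat \<Rightarrow> real \<Rightarrow> real \<Rightarrow> real \<Rightarrow> real" where
  "warp n r0 a r = 1 + a / r ^ (n - 1) - r0 ^ n / r ^ n"

lemma profile_metric_warp:
  "profile_metric (profile n l r0 a) =
    torus_metric (\<lambda>r. l\<^sup>2 / r\<^sup>2 * (1 / warp n r0 a r)) (\<lambda>r. r\<^sup>2 / l\<^sup>2 * warp n r0 a r)"
proof -
  have "(\<lambda>r. 1 / profile n l r0 a r) = (\<lambda>r. l\<^sup>2 / r\<^sup>2 * (1 / warp n r0 a r))"
    by (simp add: fun_eq_iff profile_def warp_def)
  moreover have "profile n l r0 a = (\<lambda>r. r\<^sup>2 / l\<^sup>2 * warp n r0 a r)"
    by (simp add: fun_eq_iff profile_def warp_def)
  ultimately show ?thesis by (simp add: profile_metric_def)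
qed

text \<open>
  This form separates the orders in \<open>u = w - 1\<close>. The linear terms \<open>- r u' - (n - 1) u\<close> come out exactly
  as \<open>- r0^n / r^n\<close>; what is left of \<open>1/w\<close> and \<open>1/w\<^sup>2\<close> after subtracting their first-order expansions
  is \<open>u\<^sup>2 / w\<close> and \<open>u\<^sup>2 (1 + 2 w) / w\<^sup>2\<close>.
\<close>

lemma energy_density_profile_metric:
  fixes x :: "'m::finite point" and l r0 a :: real
  defines "n \<equiv> CARD('m) + 2"
  defines "w \<equiv> warp n r0 a (x $ Rad)"
  assumes l: "l > 0" and r: "x $ Rad > 0" and w: "w \<noteq> 0"
  shows "energy_density l (profile_metric (profile n l r0 a)) x =
    1 / l * ((w - 1)\<^sup>2 * ((real n - 4) / w + (1 + 2 * w) / w\<^sup>2) - r0 ^ n / (x $ Rad) ^ n)"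
proof -
  define m where "m = CARD('m)"
  define r where "r = x $ Rad"
  define p where "p = a / r ^ (n - 1)"
  define q where "q = r0 ^ n / r ^ n"
  have n: "n = m + 2" by (simp add: n_def m_def)
  have r0: "r > 0" using r by (simp add: r_def)
  have wpq: "w = 1 + p - q" by (simp add: w_def warp_def p_def q_def r_def)
  define w' where "w' = (real n * q - (real m + 1) * p) / r"
  have dw: "(warp n r0 a has_real_derivative w') (at (x $ Rad))"
  proof -
    have "((\<lambda>r. 1 + a / r ^ (m + 1) - r0 ^ n / r ^ (m + 2)) has_real_derivative
        0 + - (real (m + 1) * a / r ^ Suc (m + 1)) - - (real (m + 2) * r0 ^ n / r ^ Suc (m + 2)))
        (at r)"
      using r0 by (intro DERIV_add DERIV_diff DERIV_const has_real_derivative_divide_power) auto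
    moreover have "0 + - (real (m + 1) * a / r ^ Suc (m + 1))
        - - (real (m + 2) * r0 ^ n / r ^ Suc (m + 2)) = w'"
      using r0 by (simp add: w'_def p_def q_def n diff_divide_distrib mult.commute)
    ultimately show ?thesis
      by (simp add: warp_def[abs_def] n r_def)
  qed
  have df: "((\<lambda>r. 1 / warp n r0 a r) has_real_derivative - w' / w\<^sup>2) (at (x $ Rad))"
    using w by (auto intro!: derivative_eq_intros dw simp: w_def power2_eq_square)
  have rw: "r * w' = real n * q - (real m + 1) * p" using r0 by (simp add: w'_def)
  have "energy_density l (profile_metric (profile n l r0 a)) x =
    1 / l * (- (r * w') + (real m + 1) * (1 / w) - w - real m - (1 / w - 1)
      + 1 / w * (1 / w + w - 2))"
    unfolding profile_metric_warp
    by (subst energy_density_torus_metric[OF l r df dw]) (simp add: w_def r_def m_def)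
  also have "\<dots> = 1 / l * ((w - 1)\<^sup>2 * ((real n - 4) / w + (1 + 2 * w) / w\<^sup>2) - q)"
  proof -
    \<comment> \<open>Eliminating \<open>p\<close> turns the claim into an identity of rational functions in \<open>w\<close>, \<open>q\<close> and \<open>m\<close>.\<close>
    have p: "p = w - 1 + q" using wpq by simp
    have "- (r * w') + (real m + 1) * (1 / w) - w - real m - (1 / w - 1) + 1 / w * (1 / w + w - 2)
        = (w - 1)\<^sup>2 * ((real n - 4) / w + (1 + 2 * w) / w\<^sup>2) - q"
      unfolding rw n p using w by (simp add: field_simps power2_eq_square)
    then show ?thesis by simp
  qed
  finally show ?thesis by (simp add: q_def r_def)
qed

text \<open>The energy density multiplied by the lapse \<open>r\<close> and by the area factor \<open>r^(n-1) / l\<close>.\<close>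

definition radial_flux :: "nat \<Rightarrow> real \<Rightarrow> real \<Rightarrow> real \<Rightarrow> real \<Rightarrow> real" where
  "radial_flux n l r0 a r = (let w = warp n r0 a r in
     (r ^ n * (w - 1)\<^sup>2 * ((real n - 4) / w + (1 + 2 * w) / w\<^sup>2) - r0 ^ n) / l\<^sup>2)"

lemma tendsto_divide_power_at_top:
  fixes c :: real
  assumes "k > 0"
  shows "((\<lambda>r. c / r ^ k) \<longlongrightarrow> 0) at_top"
  using assms by (intro tendsto_divide_0[OF tendsto_const] filterlim_at_top_imp_at_infinity
      filterlim_pow_at_top filterlim_ident) auto

lemma tendsto_warp:
  assumes "n \<ge> 2"
  shows "(warp n r0 a \<longlongrightarrow> 1) at_top"
proof -
  have "((\<lambda>r. 1 + a / r ^ (n - 1) - r0 ^ n / r ^ n) \<longlongrightarrow> 1 + 0 - 0) at_top"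
    using assms by (intro tendsto_intros tendsto_divide_power_at_top) auto
  then show ?thesis by (simp add: warp_def[abs_def])
qed

text \<open>
  This is where dimension at least 3 enters: \<open>u\<close> is of order \<open>r^(1-n)\<close>, so \<open>r^n u\<^sup>2\<close> is of order
  \<open>r^(2-n)\<close>. For \<open>n = 2\<close> the limit would be \<open>a\<^sup>2\<close>.
\<close>

lemma tendsto_warp_square:
  assumes "n \<ge> 3"
  shows "((\<lambda>r. r ^ n * (warp n r0 a r - 1)\<^sup>2) \<longlongrightarrow> 0) at_top"
proof -
  obtain m where n: "n = m + 2" and m: "m > 0"
    using assms by (auto intro: that[of "n - 2"])
  have "((\<lambda>r. 1 / r ^ m * (a - r0 ^ n / r ^ 1)\<^sup>2) \<longlongrightarrow> 0 * (a - 0)\<^sup>2) at_top"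
    using m by (intro tendsto_intros tendsto_divide_power_at_top) auto
  moreover have "\<forall>\<^sub>F r in at_top. 1 / r ^ m * (a - r0 ^ n / r ^ 1)\<^sup>2
      = r ^ n * (warp n r0 a r - 1)\<^sup>2"
  proof (rule eventually_mono[OF eventually_gt_at_top[of 0]])
    fix r :: real assume r: "r > 0"
    have w: "warp n r0 a r - 1 = (a - r0 ^ n / r ^ 1) / r ^ (m + 1)"
      using r by (simp add: warp_def n field_simps)
    have "r ^ n / (r ^ (m + 1))\<^sup>2 = 1 / r ^ m"
      using r by (simp add: n power_add power2_eq_square)
    then have "1 / r ^ m * (a - r0 ^ n / r ^ 1)\<^sup>2
        = r ^ n / (r ^ (m + 1))\<^sup>2 * (a - r0 ^ n / r ^ 1)\<^sup>2"
      by (simp only:)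
    also have "\<dots> = r ^ n * (warp n r0 a r - 1)\<^sup>2"
      unfolding w power_divide by simp
    finally show "1 / r ^ m * (a - r0 ^ n / r ^ 1)\<^sup>2 = r ^ n * (warp n r0 a r - 1)\<^sup>2" .
  qed
  ultimately have "((\<lambda>r. r ^ n * (warp n r0 a r - 1)\<^sup>2) \<longlongrightarrow> 0 * (a - 0)\<^sup>2) at_top"
    by (rule Lim_transform_eventually)
  then show ?thesis by (simp only: mult_zero_left)
qed

lemma tendsto_radial_flux:
  assumes "n \<ge> 3"
  shows "(radial_flux n l r0 a \<longlongrightarrow> - (r0 ^ n / l\<^sup>2)) at_top"
proof -
  note w = tendsto_warp[of n r0 a] and s = tendsto_warp_square[OF assms, of r0 a]
  have "((\<lambda>r. (r ^ n * (warp n r0 a r - 1)\<^sup>2 * ((real n - 4) / warp n r0 a r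
      + (1 + 2 * warp n r0 a r) / (warp n r0 a r)\<^sup>2) - r0 ^ n) * (1 / l\<^sup>2))
    \<longlongrightarrow> (0 * ((real n - 4) / 1 + (1 + 2 * 1) / 1\<^sup>2) - r0 ^ n) * (1 / l\<^sup>2)) at_top"
    using assms by (intro tendsto_intros s w) auto
  then show ?thesis by (simp add: radial_flux_def[abs_def] Let_def)
qed

lemma eventually_energy_form_profile_metric:
  fixes l r0 a :: real
  defines "n \<equiv> CARD('m) + 2"
  assumes l: "l > 0"
  shows "\<forall>\<^sub>F r in at_top. energy_form l (profile_metric (profile n l r0 a) :: 'm::finite tensor2) r
    = (\<lambda>_. radial_flux n l r0 a r)"
proof -
  have "\<forall>\<^sub>F r in at_top. warp n r0 a r > 0"
    by (rule order_tendstoD(1)[OF tendsto_warp]) (auto simp: n_def)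
  with eventually_gt_at_top[of 0] show ?thesis
  proof eventually_elim
    case (elim r)
    define w where "w = warp n r0 a r"
    define K where "K = (real n - 4) / w + (1 + 2 * w) / w\<^sup>2"
    have R: "torus_point r y $ Rad = r" for y :: "real \<times> (real ^ 'm)"
      by (simp add: torus_point_def)
    have rn: "r * (r / l * r ^ CARD('m)) = r ^ n / l"
      by (simp add: n_def power2_eq_square power_add)
    have "energy_form l (profile_metric (profile n l r0 a) :: 'm tensor2) r y
        = radial_flux n l r0 a r" for y
    proof -
      have "energy_form l (profile_metric (profile n l r0 a) :: 'm tensor2) r y
          = energy_density l (profile_metric (profile n l r0 a)) (torus_point r y) * (r ^ n / l)"
        unfolding energy_form_def mult.assoc rn ..
      also have "energy_density l (profile_metric (profile n l r0 a)) (torus_point r y)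
          = 1 / l * ((w - 1)\<^sup>2 * K - r0 ^ n / r ^ n)"
        using energy_density_profile_metric[of l "torus_point r y" r0 a] elim l
        by (simp add: R w_def K_def n_def)
      also have "1 / l * ((w - 1)\<^sup>2 * K - r0 ^ n / r ^ n) * (r ^ n / l)
          = (r ^ n * (w - 1)\<^sup>2 * K - r0 ^ n) / l\<^sup>2"
        using elim(1) l by (simp add: field_simps power2_eq_square[of l])
      also have "\<dots> = radial_flux n l r0 a r"
        by (simp add: radial_flux_def w_def K_def Let_def)
      finally show ?thesis .
    qed
    then show ?case by blast
  qed
qed

lemma measure_torus_cell:
  assumes "b \<ge> 0" "\<forall>i. L $ i > 0"
  shows "measure lborel (torus_cell b L) = b * (\<Prod>i\<in>UNIV. L $ i)"
proof -
  have "cbox 0 L \<noteq> {}"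
    using assms(2) by (simp add: interval_ne_empty_cart less_imp_le)
  then show ?thesis
    using assms(1) by (simp add: torus_cell_def content_Pair content_cbox_cart)
qed

lemma energy_profile_metric:
  fixes l r0 a b :: real and L :: "real ^ 'm::finite"
  defines "n \<equiv> CARD('m) + 2"
  defines "g \<equiv> profile_metric (profile n l r0 a) :: 'm tensor2"
  assumes l: "l > 0" and b: "b > 0" and L: "\<forall>i. L $ i > 0"
  shows "energy_well_defined l b L g"
    and "hamiltonian_energy l b L g = - (b / (8 * pi * l ^ 3)) * r0 ^ n"
proof -
  define P where "P = (\<Prod>i\<in>UNIV. L $ i)"
  have P: "P > 0" using L by (auto simp: P_def intro: prod_pos)
  have n3: "n \<ge> 3" using zero_less_card_finite[where 'a = 'm] by (simp add: n_def)
  have cell: "torus_cell b L \<in> sets lborel" "emeasure lborel (torus_cell b L) < \<infinity>"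
    by (auto simp: torus_cell_def emeasure_lborel_cbox_eq)
  have form: "\<forall>\<^sub>F r in at_top. energy_form l g r = (\<lambda>_. radial_flux n l r0 a r)"
    unfolding g_def n_def by (rule eventually_energy_form_profile_metric[OF l])
  have int: "\<forall>\<^sub>F r in at_top. set_integrable lborel (torus_cell b L) (energy_form l g r)"
    using form
  proof eventually_elim
    case (elim r)
    show ?case
      unfolding elim set_integrable_def using cell by (simp add: integrable_real_indicator)
  qed
  have flux: "\<forall>\<^sub>F r in at_top. b * P * radial_flux n l r0 a r = energy_flux l b L g r"
    using form
  proof eventually_elim
    case (elim r)
    show ?case
      unfolding energy_flux_def elim using cell b
      by (subst set_integral_const) (auto simp: measure_torus_cell[OF _ L] P_def)
  qed
  have "((\<lambda>r. b * P * radial_flux n l r0 a r) \<longlongrightarrow> b * P * - (r0 ^ n / l\<^sup>2)) at_top"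
    by (intro tendsto_intros tendsto_radial_flux n3)
  then have lim: "(energy_flux l b L g \<longlongrightarrow> b * P * - (r0 ^ n / l\<^sup>2)) at_top"
    using flux by (simp cong: tendsto_cong)
  show "energy_well_defined l b L g"
    using int lim by (auto simp: energy_well_defined_def)
  have "Lim at_top (energy_flux l b L g) = b * P * - (r0 ^ n / l\<^sup>2)"
    by (rule tendsto_Lim[OF _ lim]) simp
  then show "hamiltonian_energy l b L g = - (b / (8 * pi * l ^ 3)) * r0 ^ n"
    using P l by (simp add: hamiltonian_energy_def ref_volume_def P_def[symmetric]
        field_simps power2_eq_square power3_eq_cube)
qed

section \<open>Comparison with the Horowitz--Myers metric\<close>

text \<open>
  Multiplying the inequality for the exponent \<open>n - 1\<close> by \<open>x\<close> leaves the surplus \<open>(n - 1) (x - 1)\<^sup>2\<close>,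
  which makes it strict.
\<close>

lemma bernoulli_strict:
  fixes x :: real
  assumes "x \<ge> 0" "x \<noteq> 1" "n \<ge> 2"
  shows "1 + real n * (x - 1) < x ^ n"
proof -
  obtain k where n: "n = Suc k" and k: "k > 0"
    using assms(3) by (cases n) auto
  have "1 + real k * (x - 1) \<le> x ^ k"
    using Bernoulli_inequality[of "x - 1" k] assms(1) by simp
  then have "x * (1 + real k * (x - 1)) \<le> x ^ n"
    using assms(1) unfolding n power_Suc by (rule mult_left_mono)
  moreover have "x * (1 + real k * (x - 1)) = 1 + real n * (x - 1) + real k * (x - 1)\<^sup>2"
    by (simp add: n algebra_simps power2_eq_square)
  moreover have "real k * (x - 1)\<^sup>2 > 0" using k assms(2) by simp
  ultimately show ?thesis by linarith
qed

theorem theoremV1: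
  fixes n :: nat and l r0 a rp \<beta> r0bar :: real and L :: "real ^ 'm::finite"
    and g g_HM :: "'m tensor2"
  assumes "n = CARD('m) + 2"
    and "l > 0" and "r0 > 0" and "\<forall>i. L $ i > 0"
    and "rp > 0" and "profile n l r0 a rp = 0"
    and "\<forall>r>0. profile n l r0 a r = 0 \<longrightarrow> r \<le> rp"
    and "g = profile_metric (profile n l r0 a)"
    and "\<beta> = 4 * pi * l\<^sup>2 / (rp * (real n - 1 + r0 ^ n / rp ^ n))"
    and "r0bar = rp / real n * (real n - 1 + r0 ^ n / rp ^ n)"
    and "g_HM = profile_metric (hm_profile n l r0bar)"
  shows "4 * pi * l\<^sup>2 / (real n * r0bar) = \<beta>
    \<and> energy_well_defined l \<beta> L g
    \<and> energy_well_defined l (4 * pi * l\<^sup>2 / (real n * r0bar)) L g_HM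
    \<and> hamiltonian_energy l \<beta> L g
        \<ge> hamiltonian_energy l (4 * pi * l\<^sup>2 / (real n * r0bar)) L g_HM
    \<and> (hamiltonian_energy l \<beta> L g
        = hamiltonian_energy l (4 * pi * l\<^sup>2 / (real n * r0bar)) L g_HM \<longleftrightarrow> a = 0)
    \<and> (a = 0 \<longrightarrow> rp = r0bar \<and> (\<forall>x. x $ Rad \<ge> rp \<longrightarrow> g x = g_HM x))"
proof -
  note n = assms(1) and l = assms(2) and r0 = assms(3) and L = assms(4) and rp = assms(5)
  have n2: "n \<ge> 2" by (simp add: n)
  define x where "x = r0 / rp"
  have x: "x > 0" using r0 rp by (simp add: x_def)
  have xn: "r0 ^ n / rp ^ n = x ^ n" by (simp add: x_def power_divide)
  have rbar: "real n * r0bar = rp * (real n - 1 + x ^ n)"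
    using n2 by (simp add: assms(10) xn)
  have period: "4 * pi * l\<^sup>2 / (real n * r0bar) = \<beta>"
    by (simp add: rbar assms(9) xn)
  have pos: "real n - 1 + x ^ n > 0" using n2 x by (intro add_nonneg_pos) auto
  have \<beta>: "\<beta> > 0" unfolding assms(9) xn using pos rp l by simp
  \<comment> \<open>The root condition at \<open>rp\<close> ties \<open>a\<close> to \<open>x\<close>.\<close>
  have "rp\<^sup>2 / l\<^sup>2 * (1 + a / rp ^ (n - 1) - x ^ n) = 0"
    using assms(6) by (simp add: profile_def xn)
  then have "a / rp ^ (n - 1) = x ^ n - 1" using rp l by simp
  then have "a = 0 \<longleftrightarrow> x ^ n = 1" using rp by auto
  also have "\<dots> \<longleftrightarrow> x = 1" using x n2 power_eq_iff_eq_base[of n x 1] by simp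
  finally have a0: "a = 0 \<longleftrightarrow> x = 1" .
  have r0x: "r0 = rp * x" using rp by (simp add: x_def)
  have eq: "r0 = r0bar" if "x = 1"
  proof -
    have "real n * r0bar = real n * rp" using that by (simp add: rbar)
    then show ?thesis using n2 that by (simp add: r0x)
  qed
  have less: "r0 < r0bar" if "x \<noteq> 1"
  proof -
    have "real n * x < real n - 1 + x ^ n"
      using bernoulli_strict[of x n] x that n2 by (simp add: algebra_simps)
    then have "real n * r0 < real n * r0bar"
      using rp unfolding rbar r0x by simp
    then show ?thesis using n2 by simp
  qed
  have hm: "g_HM = profile_metric (profile n l r0bar 0)"
    by (simp add: assms(11) hm_profile_def[abs_def] profile_def[abs_def])
  note E = energy_profile_metric[OF l \<beta> L, folded n]
  have wd: "energy_well_defined l \<beta> L g" "energy_well_defined l \<beta> L g_HM"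
    unfolding assms(8) hm by (rule E(1))+
  have Eg: "hamiltonian_energy l \<beta> L g = - (\<beta> / (8 * pi * l ^ 3)) * r0 ^ n"
    unfolding assms(8) by (rule E(2))
  have Eh: "hamiltonian_energy l \<beta> L g_HM = - (\<beta> / (8 * pi * l ^ 3)) * r0bar ^ n"
    unfolding hm by (rule E(2))
  have c: "\<beta> / (8 * pi * l ^ 3) > 0" using \<beta> l by simp
  have energy: "hamiltonian_energy l \<beta> L g_HM \<le> hamiltonian_energy l \<beta> L g
      \<and> (hamiltonian_energy l \<beta> L g = hamiltonian_energy l \<beta> L g_HM \<longleftrightarrow> a = 0)"
  proof (cases "x = 1")
    case True
    then show ?thesis using eq a0 by (simp add: Eg Eh)
  next
    case False
    then have "r0 ^ n < r0bar ^ n"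
      using less r0 n2 by (intro power_strict_mono) auto
    then have "\<beta> / (8 * pi * l ^ 3) * r0 ^ n < \<beta> / (8 * pi * l ^ 3) * r0bar ^ n"
      using c by (rule mult_strict_left_mono)
    then show ?thesis using False a0 unfolding Eg Eh by linarith
  qed
  have rigid: "rp = r0bar \<and> g = g_HM" if "a = 0"
    using that a0 eq r0x unfolding hm assms(8) by simp
  show ?thesis
    unfolding period using wd energy rigid by simp
qed

end
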